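(* Let $n_1,\dots,n_d$ be positive integers and $\mathbf r=(r_1,\dots,r_d)$ positive integers with $r_k\le n_k$. Let $$\mathcal M=\left\{(\mathcal X,\mathbf P_1,\dots,\mathbf P_d):\ \mathcal X\in\mathbb R^{n_1\times\cdots\times n_d},\ \mathbf P_k\in\mathrm{Gr}(n_k-r_k,n_k),\ \mathcal X\times_k\mathbf P_k=0\ \text{ for } k=1,\dots,d\right\}.$$ The Tucker tensor variety $\mathbb R^{n_1\times\cdots\times n_d}_{\le\mathbf r}$ is parametrized by $\mathcal M$ via the mapping $\varphi:\mathcal M\to\mathbb R^{n_1\times\cdots\times n_d}_{\le\mathbf r}$, $\varphi(\mathcal X,\mathbf P_1,\dots,\mathbf P_d)=\mathcal X$; that is, $\varphi(\mathcal M)=\mathbb R^{n_1\times\cdots\times n_d}_{\le\mathbf r}$.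
   Context: $\mathrm{Gr}(s,n)=\{\mathbf P\in\mathbb R^{n\times n}:\mathbf P^\top=\mathbf P,\ \mathrm{rank}(\mathbf P)=s,\ \mathbf P=\mathbf P^2\}$. The $k$-mode product $\mathcal X\times_k\mathbf A$ of a tensor with $\mathbf A\in\mathbb R^{M\times n_k}$ has entries $\sum_{i_k}\mathbf A(j,i_k)\mathcal X(i_1,\dots,i_d)$ at position $(i_1,\dots,i_{k-1},j,i_{k+1},\dots,i_d)$. The mode-$k$ unfolding $\mathbf X_{(k)}\in\mathbb R^{n_k\times\prod_{i\ne k}n_i}$ of $\mathcal X$ is the matrix with rows indexed by $i_k$ and columns by the remaining indices. The Tucker rank is $\mathrm{rank}_{\mathrm{tc}}(\mathcal X)=(\mathrm{rank}(\mathbf X_{(1)}),\dots,\mathrm{rank}(\mathbf X_{(d)}))$ and $\mathbb R^{n_1\times\cdots\times n_d}_{\le\mathbf r}=\{\mathcal X:\mathrm{rank}_{\mathrm{tc}}(\mathcal X)\le\mathbf r\}$ with entrywise inequality. *)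

theory Defs
  imports "Jordan_Normal_Form.DL_Rank" "HOL-Library.FuncSet"
begin

(* Modes and indices are 0-based. A tensor of size ns = [n_0, ..., n_(d-1)] is a function on
   multi-indices (lists of length d) which is undefined outside the index box, so that two
   tensors of the same size are equal iff their entries are. *)

definition indices :: "nat list \<Rightarrow> nat list set" where
  "indices ns = {is. length is = length ns \<and> (\<forall>k<length ns. is ! k < ns ! k)}"

definition tensors :: "nat list \<Rightarrow> (nat list \<Rightarrow> real) set" where
  "tensors ns = indices ns \<rightarrow>\<^sub>E UNIV"

definition zero_tensor :: "nat list \<Rightarrow> nat list \<Rightarrow> real" where
  "zero_tensor ns = restrict (\<lambda>is. 0) (indices ns)"

(* Meaningful for A with dim_col A = ns ! k; the result has size ns[k := dim_row A]. *)
definition mode_prod :: "nat list \<Rightarrow> nat \<Rightarrow> (nat list \<Rightarrow> real) \<Rightarrow> real mat \<Rightarrow> (nat list \<Rightarrow> real)" where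
  "mode_prod ns k X A =
     restrict (\<lambda>is. \<Sum>i<ns ! k. A $$ (is ! k, i) * X (is[k := i])) (indices (ns[k := dim_row A]))"

definition drop_mode :: "nat \<Rightarrow> 'a list \<Rightarrow> 'a list" where
  "drop_mode k xs = take k xs @ drop (Suc k) xs"

definition insert_mode :: "nat \<Rightarrow> 'a \<Rightarrow> 'a list \<Rightarrow> 'a list" where
  "insert_mode k i js = take k js @ i # drop k js"

definition index_list :: "nat list \<Rightarrow> nat list list" where
  "index_list ns = product_lists (map (\<lambda>n. [0..<n]) ns)"

(* The columns are the remaining multi-indices, enumerated lexicographically. *)
definition unfolding_mat :: "nat list \<Rightarrow> nat \<Rightarrow> (nat list \<Rightarrow> real) \<Rightarrow> real mat" where
  "unfolding_mat ns k X =
     mat (ns ! k) (prod_list (drop_mode k ns))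
       (\<lambda>(i, j). X (insert_mode k i (index_list (drop_mode k ns) ! j)))"

definition tucker_rank :: "nat list \<Rightarrow> (nat list \<Rightarrow> real) \<Rightarrow> nat list" where
  "tucker_rank ns X = map (\<lambda>k. vec_space.rank (ns ! k) (unfolding_mat ns k X)) [0..<length ns]"

definition tucker_variety :: "nat list \<Rightarrow> nat list \<Rightarrow> (nat list \<Rightarrow> real) set" where
  "tucker_variety ns rs = {X \<in> tensors ns. list_all2 (\<le>) (tucker_rank ns X) rs}"

definition Gr :: "nat \<Rightarrow> nat \<Rightarrow> real mat set" where
  "Gr s n = {P \<in> carrier_mat n n. transpose_mat P = P \<and> vec_space.rank n P = s \<and> P = P ^\<^sub>m 2}"

definition param_set :: "nat list \<Rightarrow> nat list \<Rightarrow> ((nat list \<Rightarrow> real) \<times> real mat list) set" where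
  "param_set ns rs = {(X, Ps). X \<in> tensors ns \<and> length Ps = length ns \<and>
     (\<forall>k<length ns. Ps ! k \<in> Gr (ns ! k - rs ! k) (ns ! k) \<and>
        mode_prod ns k X (Ps ! k) = zero_tensor ns)}"

definition param_map :: "(nat list \<Rightarrow> real) \<times> real mat list \<Rightarrow> (nat list \<Rightarrow> real)" where
  "param_map = (\<lambda>(X, Ps). X)"

lemma set_index_list: "set (index_list ns) = indices ns"
  by (auto simp: index_list_def indices_def product_lists_set list_all2_conv_all_nth)

lemma distinct_index_list: "distinct (index_list ns)"
  unfolding index_list_def by (rule distinct_product_lists) auto

lemma length_index_list: "length (index_list ns) = prod_list ns"
  unfolding index_list_def by (induction ns) (auto simp: length_concat comp_def sum_list_triv)

end

theory Submission
  imports Defs "Jordan_Normal_Form.Matrix_Kernel"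
begin

text \<open>
  The condition on the \<open>k\<close>-mode product says that the projector annihilates the mode-\<open>k\<close> unfolding
  from the left, so the claim reduces, one mode at a time, to a statement about a matrix \<open>A\<close> with
  \<open>n\<close> rows: \<open>rank A \<le> r\<close> iff \<open>P A = 0\<close> for some orthogonal projector \<open>P\<close> of rank \<open>n - r\<close>. If such
  a \<open>P\<close> exists, rank-nullity bounds \<open>rank A\<close>. Conversely, at most \<open>r\<close> columns span the column
  space of \<open>A\<close>, so there are \<open>n - r\<close> orthonormal vectors orthogonal to it; with these as the columns
  of \<open>Q\<close>, take \<open>P = Q Q\<^sup>T\<close>.
\<close>

section \<open>Kernels, ranks and rank factorization\<close>

text \<open>Padding \<open>A\<close> with zero rows to a square matrix preserves the equations
  \<open>A *\<^sub>v v = 0\<^sub>v t\<close>. Since \<open>t < s\<close>, row \<open>t\<close> is a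
  zero row, so the determinant vanishes.\<close>

lemma wide_mat_kernel_vec:
  fixes A :: "'a :: field mat"
  assumes A: "A \<in> carrier_mat t s" and ts: "t < s"
  obtains v where "v \<in> carrier_vec s" "v \<noteq> 0\<^sub>v s" "A *\<^sub>v v = 0\<^sub>v t"
proof -
  let ?A = "mat\<^sub>r s s (\<lambda>i. if i = t then 0\<^sub>v s else if i < t then row A i else 0\<^sub>v s)"
  have "det ?A = 0"
    using A by (intro det_row_0 ts) auto
  then obtain v where v: "v \<in> carrier_vec s" "v \<noteq> 0\<^sub>v s" "?A *\<^sub>v v = 0\<^sub>v s"
    using det_0_iff_vec_prod_zero_field[of ?A s] by auto
  have "A *\<^sub>v v = 0\<^sub>v t"
  proof (rule eq_vecI)
    fix i assume "i < dim_vec (0\<^sub>v t :: 'a vec)"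
    then have i: "i < t" by simp
    have "(?A *\<^sub>v v) $ i = 0" using v(3) i ts by simp
    then show "(A *\<^sub>v v) $ i = 0\<^sub>v t $ i" using i ts A by simp
  qed (use A in simp)
  with v that show thesis by blast
qed

lemma (in vec_space) dim_span_le_subspace:
  assumes sub: "subspace class_ring W V" and fd: "vectorspace.fin_dim class_ring (vs W)"
    and S: "S \<subseteq> W" and fin: "finite S"
  shows "vectorspace.dim class_ring (span_vs S) \<le> vectorspace.dim class_ring (vs W)"
proof -
  have sm: "submodule class_ring W V" using sub by (simp add: subspace_def)
  have vsW: "vectorspace class_ring (vs W)" using subspace_is_vs[OF sub] .
  have SV: "S \<subseteq> carrier V" using S submodule.subset[OF sm] by blast
  \<comment> \<open>The span of \<open>S\<close> is the same whether formed in \<open>W\<close> or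
    in the whole space, so it can be treated as a subspace of \<open>W\<close>.\<close>
  have "subspace class_ring (span S) (vs W)"
    using vectorspace.span_is_subspace[OF vsW, of S] S
    by (simp add: span_li_not_depend(1)[OF S sm])
  moreover have "vectorspace.fin_dim class_ring (vs W\<lparr>carrier := span S\<rparr>)"
    using fin_dim_span[OF fin SV] by simp
  ultimately show ?thesis
    using vectorspace.subspace_dim[OF vsW _ fd] by simp
qed

text \<open>Each column of \<open>B * C\<close> is \<open>B\<close> applied to a column of
  \<open>C\<close>, hence lies in the column space of \<open>B\<close>.\<close>

lemma (in vec_space) rank_mult_le_left:
  assumes B: "B \<in> carrier_mat n r" and C: "C \<in> carrier_mat r m"
  shows "rank (B * C) \<le> rank B"
proof -
  have "set (cols (B * C)) \<subseteq> span (set (cols B))"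
  proof
    fix v assume "v \<in> set (cols (B * C))"
    then obtain j where "j < m" "v = col (B * C) j"
      using B C by (metis carrier_matD(2) cols_length cols_nth in_set_conv_nth index_mult_mat(3))
    then have "v = B *\<^sub>v col C j" "col C j \<in> carrier_vec r"
      using B C by auto
    then have "v \<in> col_space B"
      using B by (auto simp: col_space_eq)
    then show "v \<in> span (set (cols B))"
      unfolding col_space_def .
  qed
  then show ?thesis
    unfolding rank_def using B cols_dim[of B]
    by (intro dim_span_le_subspace span_is_subspace fin_dim_span_cols[OF B]) auto
qed

lemma (in vec_space) rank_mult_le:
  assumes "B \<in> carrier_mat n r" and "C \<in> carrier_mat r m"
  shows "rank (B * C) \<le> r"
  using rank_mult_le_left[OF assms] rank_le_nc[OF assms(1)] by linarith

text \<open>The columns of \<open>B\<close> are a maximal independent set of columns of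
  \<open>A\<close>; column \<open>j\<close> of \<open>C\<close> holds coordinates of column
  \<open>j\<close> of \<open>A\<close> with respect to them.\<close>

lemma (in vec_space) rank_factorization:
  assumes A: "A \<in> carrier_mat n m"
  obtains B C where "B \<in> carrier_mat n (rank A)" "C \<in> carrier_mat (rank A) m" "A = B * C"
proof -
  obtain U where U: "maximal U (\<lambda>T. T \<subseteq> set (cols A) \<and> lin_indpt T)" "finite U"
    using maximal_exists_superset[of "set (cols A)" "\<lambda>T. T \<subseteq> set (cols A) \<and> lin_indpt T" "{}"]
    by (meson List.finite_set empty_subsetI finite_basis_exists[OF fin_dim] basis_def subset_li_is_li)
  have cA: "set (cols A) \<subseteq> carrier_vec n" using A cols_dim by blast
  have UA: "U \<subseteq> set (cols A)" "lin_indpt U" using U(1) by (auto simp: maximal_def)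
  have cU: "U \<subseteq> carrier_vec n" using UA(1) cA by blast
  obtain us where us: "set us = U" "distinct us" using finite_distinct_list[OF U(2)] by blast
  have len: "length us = rank A"
    using rank_card_indpt[OF A U(1)] us distinct_card by metis
  define B where "B = mat_of_cols n us"
  have B: "B \<in> carrier_mat n (rank A)" unfolding B_def using len by auto
  have "set (cols B) = U" unfolding B_def using us cU by (simp add: cols_mat_of_cols)
  then have span_B: "span U = col_space B" unfolding col_space_def by simp
  have col: "\<exists>x\<in>carrier_vec (rank A). B *\<^sub>v x = a" if a: "a \<in> set (cols A)" for a
  proof -
    \<comment> \<open>A column outside \<open>span U\<close> could be added to \<open>U\<close>
      without losing independence, against maximality.\<close>
    have "a \<in> span U"
    proof (rule ccontr)
      assume na: "a \<notin> span U"
      have "lin_indpt (insert a U)"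
        using lin_dep_iff_in_span[OF _ UA(2), of a] na a cA cU span_mem[of U a] by auto
      then have "insert a U = U"
        using U(1) a UA(1) unfolding maximal_def by blast
      then show False using na cU span_mem[of U a] by auto
    qed
    then show ?thesis using B unfolding span_B by (auto simp: col_space_eq)
  qed
  then obtain f where f: "f a \<in> carrier_vec (rank A)" "B *\<^sub>v f a = a" if "a \<in> set (cols A)" for a
    by metis
  define C where "C = mat_of_cols (rank A) (map f (cols A))"
  have C: "C \<in> carrier_mat (rank A) m" unfolding C_def using A by auto
  have "A = B * C"
  proof (rule mat_col_eqI)
    fix j assume "j < dim_col (B * C)"
    then have j: "j < m" using C by simp
    have "col A j \<in> set (cols A)" using j A by (metis carrier_matD(2) cols_length cols_nth nth_mem)
    moreover from this have "col C j = f (col A j)"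
      unfolding C_def using j A f by (subst col_mat_of_cols) auto
    ultimately show "col A j = col (B * C) j"
      using f unfolding col_mult2[OF B C j] by simp
  qed (use A B C in auto)
  with B C that show thesis by blast
qed

text \<open>The columns of \<open>B\<close> lie in the kernel of \<open>A\<close>, so
  \<open>rank B\<close> is at most the nullity of \<open>A\<close>, and rank-nullity
  concludes.\<close>

lemma rank_add_rank_le:
  fixes A B :: "'a :: field mat"
  assumes A: "A \<in> carrier_mat l n" and B: "B \<in> carrier_mat n m" and AB: "A * B = 0\<^sub>m l m"
  shows "vec_space.rank l A + vec_space.rank n B \<le> n"
proof -
  interpret L: vec_space "TYPE('a)" l .
  interpret N: vec_space "TYPE('a)" n .
  have "(\<lambda>v. A *\<^sub>v v) \<in> LinearCombinations.module_hom class_ring N.V L.V"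
    using A by (auto simp: LinearCombinations.module_hom_def mult_add_distrib_mat_vec[OF A] mult_mat_vec[OF A])
  then interpret T: linear_map class_ring N.V L.V "\<lambda>v. A *\<^sub>v v"
    by (intro linear_map.intro mod_hom.intro mod_hom_axioms.intro vec_vs vec_module)
  have im: "T.im = L.span (set (cols A))"
    using L.col_space_eq[OF A] A unfolding L.col_space_def T.im_def by auto
  have sub: "subspace class_ring T.ker N.V" using T.kerT_is_subspace .
  have "vec_space.rank n B \<le> vectorspace.dim class_ring (N.vs T.ker)"
  proof -
    have S: "set (cols B) \<subseteq> T.ker"
    proof
      fix v assume "v \<in> set (cols B)"
      then obtain j where "j < m" "v = col B j"
        using B by (metis carrier_matD(2) cols_length cols_nth in_set_conv_nth)
      then have "A *\<^sub>v v = col (0\<^sub>m l m) j" "v \<in> carrier_vec n"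
        using A B by (auto simp: AB[symmetric])
      then show "v \<in> T.ker" using \<open>j < m\<close> by (auto simp: T.ker_def)
    qed
    \<comment> \<open>Finite dimension comes from the basis of the matrix kernel, which is the
      kernel of the linear map.\<close>
    have "vectorspace.fin_dim class_ring (N.vs T.ker)"
    proof -
      interpret K: kernel l n A using A by unfold_locales
      obtain S where "finite S" "K.basis S" using kernel_basis_exists[OF A] by blast
      then have "K.Ker.fin_dim" unfolding K.Ker.fin_dim_def K.Ker.basis_def by auto
      moreover have "T.ker = mat_kernel A" using A by (auto simp: T.ker_def mat_kernel_def)
      ultimately show ?thesis by simp
    qed
    then show ?thesis
      unfolding N.rank_def by (intro N.dim_span_le_subspace[OF sub _ S]) auto
  qed
  moreover have "L.rank A + vectorspace.dim class_ring (N.vs T.ker) = n"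
    using T.rank_nullity N.dim_is_n N.fin_dim unfolding L.rank_def im by simp
  ultimately show ?thesis by linarith
qed

section \<open>Orthonormal columns and the projectors they define\<close>

text \<open>Vectors are added one at a time: being orthogonal to the \<open>s\<close> vectors found
  so far and to the \<open>t\<close> columns of \<open>B\<close> is a system of
  \<open>s + t < n\<close> linear equations, so a nonzero solution exists and can be
  normalized.\<close>

lemma orthonormal_extension:
  fixes B :: "real mat"
  assumes B: "B \<in> carrier_mat n t"
  shows "s + t \<le> n \<Longrightarrow> \<exists>Q\<in>carrier_mat n s. Q\<^sup>T * Q = 1\<^sub>m s \<and> Q\<^sup>T * B = 0\<^sub>m s t"
proof (induction s)
  case 0
  show ?case
    by (intro bexI[of _ "0\<^sub>m n 0"]) (use B in \<open>auto intro!: eq_matI\<close>)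
next
  case (Suc s)
  then obtain Q where Q: "Q \<in> carrier_mat n s" "Q\<^sup>T * Q = 1\<^sub>m s" "Q\<^sup>T * B = 0\<^sub>m s t"
    by auto
  \<comment> \<open>A kernel vector of the stacked matrix is orthogonal to all columns of
    \<open>Q\<close> and of \<open>B\<close>.\<close>
  have "Q\<^sup>T @\<^sub>r B\<^sup>T \<in> carrier_mat (s + t) n" using Q(1) B by auto
  then obtain w where w: "w \<in> carrier_vec n" "w \<noteq> 0\<^sub>v n" "(Q\<^sup>T @\<^sub>r B\<^sup>T) *\<^sub>v w = 0\<^sub>v (s + t)"
    using wide_mat_kernel_vec[of _ "s + t" n] Suc.prems by auto
  have "0\<^sub>v (s + t) = 0\<^sub>v s @\<^sub>v (0\<^sub>v t :: real vec)" by auto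
  then have wapp: "(Q\<^sup>T *\<^sub>v w) @\<^sub>v (B\<^sup>T *\<^sub>v w) = 0\<^sub>v s @\<^sub>v 0\<^sub>v t"
    using mat_mult_append[of "Q\<^sup>T" s n "B\<^sup>T" t w] w Q(1) B by simp
  have wQB: "Q\<^sup>T *\<^sub>v w = 0\<^sub>v s" "B\<^sup>T *\<^sub>v w = 0\<^sub>v t"
    using append_vec_eq[of "Q\<^sup>T *\<^sub>v w" s "0\<^sub>v s" "B\<^sup>T *\<^sub>v w" "0\<^sub>v t"] wapp Q(1) w(1)
    by simp_all
  have ww: "w \<bullet> w > 0"
    using w conjugate_square_greater_0_vec[of w n] by (simp add: scalar_prod_def)
  define v where "v = (1 / sqrt (w \<bullet> w)) \<cdot>\<^sub>v w"
  have v: "v \<in> carrier_vec n" unfolding v_def using w by simp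
  have vv: "v \<bullet> v = 1" unfolding v_def using ww w by simp
  have vQ: "col Q i \<bullet> v = 0" if "i < s" for i
  proof -
    have "col Q i \<bullet> w = (Q\<^sup>T *\<^sub>v w) $ i" using that Q(1) by simp
    then show ?thesis unfolding v_def using wQB that w Q(1) by simp
  qed
  have Qv: "v \<bullet> col Q i = 0" if "i < s" for i
    using vQ[OF that] comm_scalar_prod[OF v, of "col Q i"] that Q(1) by simp
  have vB: "v \<bullet> col B j = 0" if "j < t" for j
  proof -
    have "col B j \<bullet> w = (B\<^sup>T *\<^sub>v w) $ j" using that B by simp
    then have "col B j \<bullet> v = 0" unfolding v_def using wQB that w B by simp
    then show ?thesis using comm_scalar_prod[OF v, of "col B j"] that B by simp
  qed
  have QQ: "col Q i \<bullet> col Q j = (if i = j then 1 else 0)" if "i < s" "j < s" for i j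
  proof -
    have "col Q i \<bullet> col Q j = (Q\<^sup>T * Q) $$ (i, j)" using that Q(1) by simp
    then show ?thesis using that Q by simp
  qed
  have QB: "col Q i \<bullet> col B j = 0" if "i < s" "j < t" for i j
  proof -
    have "col Q i \<bullet> col B j = (Q\<^sup>T * B) $$ (i, j)" using that Q(1) B by simp
    then show ?thesis using that Q by simp
  qed
  define Q' where "Q' = mat_of_cols n (cols Q @ [v])"
  have Q': "Q' \<in> carrier_mat n (Suc s)" unfolding Q'_def using Q(1) by auto
  have colQ': "col Q' i = (if i < s then col Q i else v)" if "i < Suc s" for i
    unfolding Q'_def using that Q(1) v
    by (subst col_mat_of_cols) (auto simp: nth_append less_Suc_eq)
  have "Q'\<^sup>T * Q' = 1\<^sub>m (Suc s)"
    using Q' Q(1) v by (intro eq_matI)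
      (auto simp: colQ' QQ vQ Qv vv less_Suc_eq)
  moreover have "Q'\<^sup>T * B = 0\<^sub>m (Suc s) t"
    using Q' B by (intro eq_matI) (auto simp: colQ' QB vB)
  ultimately show ?case using Q' by blast
qed

text \<open>Idempotence is cancellation of the inner \<open>Q\<^sup>T * Q\<close>. The rank is at
  most \<open>s\<close> because the product factors through dimension \<open>s\<close>, and at least
  \<open>s\<close> because the projector fixes every \<open>Q *\<^sub>v v\<close> and
  \<open>Q\<close> is injective.\<close>

lemma orthonormal_projector_in_Gr:
  assumes Q: "Q \<in> carrier_mat n s" and QQ: "Q\<^sup>T * Q = 1\<^sub>m s"
  shows "Q * Q\<^sup>T \<in> Gr s n"
proof -
  interpret vec_space "TYPE(real)" n .
  let ?P = "Q * Q\<^sup>T"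
  have QT: "Q\<^sup>T \<in> carrier_mat s n" using Q by simp
  have P: "?P \<in> carrier_mat n n" using Q by simp
  have "?P * ?P = Q * (Q\<^sup>T * ?P)"
    using Q by (intro assoc_mult_mat) auto
  also have "Q\<^sup>T * ?P = Q\<^sup>T * Q * Q\<^sup>T"
    using Q by (intro assoc_mult_mat[symmetric]) auto
  finally have idem: "?P * ?P = ?P" using Q by (simp add: QQ)
  define k where k: "k = rank ?P"
  obtain B C where B: "B \<in> carrier_mat n k" and C: "C \<in> carrier_mat k n" and PBC: "?P = B * C"
    using rank_factorization[OF P] unfolding k .
  \<comment> \<open>If \<open>k < s\<close>, the wide matrix \<open>C * Q\<close> kills some
    \<open>v \<noteq> 0\<close>. Then \<open>?P\<close> kills \<open>Q *\<^sub>v v\<close>, although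
    it also fixes it, so \<open>Q *\<^sub>v v\<close> is zero, and applying the left inverse
    \<open>Q\<^sup>T\<close> gives \<open>v = 0\<close>.\<close>
  have "s \<le> k"
  proof (rule ccontr)
    assume "\<not> s \<le> k"
    moreover have CQ: "C * Q \<in> carrier_mat k s" using C Q by simp
    ultimately obtain v where v: "v \<in> carrier_vec s" "v \<noteq> 0\<^sub>v s" "(C * Q) *\<^sub>v v = 0\<^sub>v k"
      using wide_mat_kernel_vec[OF CQ] by auto
    have Qv: "Q *\<^sub>v v \<in> carrier_vec n" using Q v by simp
    have "?P *\<^sub>v (Q *\<^sub>v v) = B *\<^sub>v (C *\<^sub>v (Q *\<^sub>v v))"
      unfolding PBC by (rule assoc_mult_mat_vec[OF B C Qv])
    also have "\<dots> = 0\<^sub>v n"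
      using v(3) B unfolding assoc_mult_mat_vec[OF C Q v(1)] by (intro eq_vecI) auto
    finally have PQv: "?P *\<^sub>v (Q *\<^sub>v v) = 0\<^sub>v n" .
    have "Q\<^sup>T *\<^sub>v (Q *\<^sub>v v) = v"
      using v(1) unfolding assoc_mult_mat_vec[OF QT Q v(1), symmetric] QQ by simp
    then have "Q *\<^sub>v v = 0\<^sub>v n"
      using PQv unfolding assoc_mult_mat_vec[OF Q QT Qv] by simp
    with \<open>Q\<^sup>T *\<^sub>v (Q *\<^sub>v v) = v\<close> have "v = Q\<^sup>T *\<^sub>v 0\<^sub>v n" by simp
    then have "v = 0\<^sub>v s" using QT by (auto intro!: eq_vecI)
    with v show False by simp
  qed
  then have "rank ?P = s" using rank_mult_le[OF Q QT] k by simp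
  then show ?thesis
    unfolding Gr_def using P idem Q by (auto simp: numeral_2_eq_2 transpose_mult[OF Q QT])
qed

lemma rank_le_iff_Gr_annihilator:
  fixes A :: "real mat"
  assumes A: "A \<in> carrier_mat n m" and r: "r \<le> n"
  shows "vec_space.rank n A \<le> r \<longleftrightarrow> (\<exists>P\<in>Gr (n - r) n. P * A = 0\<^sub>m n m)"
proof
  interpret vec_space "TYPE(real)" n .
  assume rank: "rank A \<le> r"
  obtain B C where BC: "B \<in> carrier_mat n (rank A)" "C \<in> carrier_mat (rank A) m" "A = B * C"
    using rank_factorization[OF A] .
  \<comment> \<open>Using \<open>B\<close> in place of \<open>A\<close> leaves only
    \<open>rank A\<close> columns to avoid, and \<open>(n - r) + rank A \<le> n\<close> makes room
    for \<open>n - r\<close> new ones.\<close>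
  obtain Q where Q: "Q \<in> carrier_mat n (n - r)" "Q\<^sup>T * Q = 1\<^sub>m (n - r)"
    "Q\<^sup>T * B = 0\<^sub>m (n - r) (rank A)"
    using orthonormal_extension[OF BC(1), of "n - r"] rank r by fastforce
  have "Q * Q\<^sup>T * A = Q * (Q\<^sup>T * B * C)"
    unfolding BC(3) using Q(1) BC(1,2)
    by (simp add: assoc_mult_mat[of Q n "n - r" "Q\<^sup>T" n "B * C" m]
        assoc_mult_mat[of "Q\<^sup>T" "n - r" n B "rank A" C m])
  also have "\<dots> = 0\<^sub>m n m" using Q BC(2) by simp
  finally show "\<exists>P\<in>Gr (n - r) n. P * A = 0\<^sub>m n m"
    using orthonormal_projector_in_Gr[OF Q(1,2)] by blast
next
  assume "\<exists>P\<in>Gr (n - r) n. P * A = 0\<^sub>m n m"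
  then obtain P where "P \<in> carrier_mat n n" "vec_space.rank n P = n - r" "P * A = 0\<^sub>m n m"
    by (auto simp: Gr_def)
  \<comment> \<open>From \<open>(n - r) + rank A \<le> n\<close>; here \<open>r \<le> n\<close>
    ensures that the subtraction is not truncated.\<close>
  then show "vec_space.rank n A \<le> r"
    using rank_add_rank_le[OF _ A, of P n] r by simp
qed

section \<open>Multi-indices, unfoldings and the mode product\<close>

lemma insert_drop_mode: "k < length xs \<Longrightarrow> insert_mode k i (drop_mode k xs) = xs[k := i]"
  by (simp add: insert_mode_def drop_mode_def upd_conv_take_nth_drop)

lemma insert_mode_nth_update:
  assumes "k \<le> length js"
  shows "insert_mode k i js ! k = i" "(insert_mode k i js)[k := l] = insert_mode k l js"
  using assms by (auto simp: insert_mode_def nth_append list_update_append)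

lemma drop_mode_in_indices:
  assumes "is \<in> indices ns" "k < length ns"
  shows "drop_mode k is \<in> indices (drop_mode k ns)"
  using assms by (auto simp: indices_def drop_mode_def nth_append min_def)

lemma insert_mode_in_indices:
  assumes js: "js \<in> indices (drop_mode k ns)" and k: "k < length ns" and i: "i < ns ! k"
  shows "insert_mode k i js \<in> indices ns"
proof -
  have len: "length js = length ns - 1" using js k by (simp add: indices_def drop_mode_def)
  have "insert_mode k i js ! l < ns ! l" if l: "l < length ns" for l
  proof -
    consider "l < k" | "l = k" | "k < l" by linarith
    then show ?thesis
    proof cases
      case 1
      then have "js ! l < drop_mode k ns ! l" using js k by (simp add: indices_def drop_mode_def)
      then show ?thesis using 1 k len by (simp add: insert_mode_def drop_mode_def nth_append)
    next
      case 2
      then show ?thesis using i insert_mode_nth_update(1)[of k js i] k len by simp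
    next
      case 3
      \<comment> \<open>Beyond the inserted entry positions shift by one: position \<open>l\<close>
        of the result is position \<open>l - 1 = k + x\<close> of \<open>js\<close>.\<close>
      then obtain x where x: "l = Suc (k + x)" using less_iff_Suc_add by auto
      then have "js ! (k + x) < drop_mode k ns ! (k + x)"
        using js k l by (auto simp: indices_def drop_mode_def)
      then show ?thesis using k len l
        by (auto simp: x insert_mode_def drop_mode_def nth_append Suc_diff_le)
    qed
  qed
  then show ?thesis using len k by (auto simp: indices_def insert_mode_def)
qed

lemma unfolding_mat_carrier:
  "unfolding_mat ns k X \<in> carrier_mat (ns ! k) (prod_list (drop_mode k ns))"
  by (simp add: unfolding_mat_def)

text \<open>Both sides have the same entries: row \<open>i\<close> and column \<open>js\<close> of
  the matrix product is the entry of the mode product at \<open>insert_mode k i js\<close>, and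
  every multi-index splits this way.\<close>

lemma mode_prod_eq_zero_iff:
  assumes k: "k < length ns" and P: "P \<in> carrier_mat (ns ! k) (ns ! k)"
  shows "mode_prod ns k X P = zero_tensor ns \<longleftrightarrow>
    P * unfolding_mat ns k X = 0\<^sub>m (ns ! k) (prod_list (drop_mode k ns))"
proof -
  let ?N = "prod_list (drop_mode k ns)" and ?L = "index_list (drop_mode k ns)"
  let ?S = "\<lambda>i js. \<Sum>l<ns ! k. P $$ (i, l) * X (insert_mode k l js)"
  have entry: "(P * unfolding_mat ns k X) $$ (i, j) = ?S i (?L ! j)"
    if "i < ns ! k" "j < ?N" for i j
    using that P
    by (auto simp: unfolding_mat_def scalar_prod_def lessThan_atLeast0 intro!: sum.cong)
  \<comment> \<open>As \<open>P\<close> is square of size \<open>ns ! k\<close>, the mode product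
    keeps the size \<open>ns\<close>.\<close>
  have "mode_prod ns k X P = zero_tensor ns \<longleftrightarrow>
      (\<forall>is\<in>indices ns. (\<Sum>l<ns ! k. P $$ (is ! k, l) * X (is[k := l])) = 0)"
    using P unfolding mode_prod_def zero_tensor_def by (auto simp: restrict_def fun_eq_iff)
  also have "\<dots> \<longleftrightarrow> (\<forall>i<ns ! k. \<forall>js\<in>indices (drop_mode k ns). ?S i js = 0)"
  proof (intro iffI ballI allI impI)
    fix i js
    assume *: "\<forall>is\<in>indices ns. (\<Sum>l<ns ! k. P $$ (is ! k, l) * X (is[k := l])) = 0"
      and i: "i < ns ! k" and js: "js \<in> indices (drop_mode k ns)"
    have "k \<le> length js" using js k by (simp add: indices_def drop_mode_def)
    then show "?S i js = 0"
      using bspec[OF * insert_mode_in_indices[OF js k i]] by (simp add: insert_mode_nth_update)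
  next
    fix "is"
    assume *: "\<forall>i<ns ! k. \<forall>js\<in>indices (drop_mode k ns). ?S i js = 0"
      and "is": "is \<in> indices ns"
    have "is ! k < ns ! k" "k < length is" using "is" k by (auto simp: indices_def)
    then show "(\<Sum>l<ns ! k. P $$ (is ! k, l) * X (is[k := l])) = 0"
      using * drop_mode_in_indices[OF "is" k] by (force simp: insert_drop_mode)
  qed
  \<comment> \<open>The list \<open>?L\<close> enumerates all remaining multi-indices, so
    quantifying over them amounts to quantifying over column numbers.\<close>
  also have "\<dots> \<longleftrightarrow> (\<forall>i<ns ! k. \<forall>j<?N. ?S i (?L ! j) = 0)"
    by (simp add: set_index_list[symmetric] all_set_conv_all_nth length_index_list)
  also have "\<dots> \<longleftrightarrow> P * unfolding_mat ns k X = 0\<^sub>m (ns ! k) ?N"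
    using P unfolding_mat_carrier[of ns k X] by (auto simp: mat_eq_iff entry simp del: index_mult_mat(1))
  finally show ?thesis .
qed

theorem proposition1:
  fixes ns rs :: "nat list"
  assumes "length rs = length ns"
    and "\<forall>k<length ns. 0 < ns ! k"
    and "\<forall>k<length ns. 0 < rs ! k \<and> rs ! k \<le> ns ! k"
  shows "param_map ` param_set ns rs = tucker_variety ns rs"
proof -
  let ?R = "\<lambda>X k P. P \<in> Gr (ns ! k - rs ! k) (ns ! k) \<and> mode_prod ns k X P = zero_tensor ns"
  have mode: "(\<exists>P. ?R X k P) \<longleftrightarrow> tucker_rank ns X ! k \<le> rs ! k" if k: "k < length ns" for X k
  proof -
    have "(\<exists>P. ?R X k P) \<longleftrightarrow> (\<exists>P\<in>Gr (ns ! k - rs ! k) (ns ! k).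
        P * unfolding_mat ns k X = 0\<^sub>m (ns ! k) (prod_list (drop_mode k ns)))"
      using mode_prod_eq_zero_iff[OF k] by (auto simp: Gr_def)
    also have "\<dots> \<longleftrightarrow> tucker_rank ns X ! k \<le> rs ! k"
      using rank_le_iff_Gr_annihilator[OF unfolding_mat_carrier] assms(3) k
      by (simp add: tucker_rank_def)
    finally show ?thesis .
  qed
  have "X \<in> param_map ` param_set ns rs \<longleftrightarrow> X \<in> tucker_variety ns rs" for X
  proof -
    have "X \<in> param_map ` param_set ns rs \<longleftrightarrow> (\<exists>Ps. (X, Ps) \<in> param_set ns rs)"
      by (force simp: param_map_def)
    also have "\<dots> \<longleftrightarrow>
        X \<in> tensors ns \<and> (\<exists>Ps. length Ps = length ns \<and> (\<forall>k<length ns. ?R X k (Ps ! k)))"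
      unfolding param_set_def by blast
    \<comment> \<open>The condition on each projector involves only its own mode, so projectors can
      be chosen separately and collected in a list.\<close>
    also have "\<dots> \<longleftrightarrow> X \<in> tensors ns \<and> (\<forall>k<length ns. \<exists>P. ?R X k P)"
      by (simp add: Skolem_list_nth)
    also have "\<dots> \<longleftrightarrow> X \<in> tucker_variety ns rs"
      using assms(1)
      by (simp add: mode tucker_variety_def list_all2_conv_all_nth) (simp add: tucker_rank_def)
    finally show ?thesis .
  qed
  then show ?thesis by blast
qed

end
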